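(* Let $\alpha\ge\omega$ be an ordinal, let $a\in\mathcal{B}^{cyl}$, let $y\in\Delta a$, and let $y_1,y_2,\dots$ be any sequence of pairwise distinct ordinals $<\alpha$ not in $\Delta a$. Then $$\lambda(\widetilde{C}^\partial_y a)=\inf_{n\in\omega}\lambda\Big(\bigcap_{i=1}^n a(y/y_i)\Big).$$
   Context: $\mathcal{B}^{cyl}$ (resp. $\mathcal{L}^{cyl}$) is the family of all sets $\{r\in[0,1)^\alpha:(r_{k_1},\dots,r_{k_n})\in A\}$ with $n\in\omega$, $k_1<\dots<k_n<\alpha$ and $A\subseteq[0,1)^n$ Borel (resp. Lebesgue measurable). $\lambda$ is the measure on $\mathcal{L}^{cyl}$ given by $\lambda(\{r:(r_{k_1},\dots,r_{k_n})\in A\})=\lambda_n(A)$, with $\lambda_n$ the $n$-dimensional Lebesgue measure. For $r\in[0,1)^\alpha$, $k<\alpha$, $u\in[0,1)$, $r^k_u$ is $r$ with its $k$-th coordinate replaced by $u$. Cylindrification: $C_k a=\{r: r^k_u\in a\text{ for some }u\}$; dimension set $\Delta a=\{k<\alpha: C_k a\neq a\}$; substitution $a(k/l)=\{r: r^k_{r_l}\in a\}$. The section of $a$ through $r$ in direction $k$ is $a^k_r=\{u\in[0,1): r^k_u\in a\}$, and $\widetilde{C}^\partial_k a=\{r\in[0,1)^\alpha: \lambda_1(a^k_r)=1\}$, $\lambda_1$ being one-dimensional Lebesgue measure. *)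

theory Defs
  imports "HOL-Analysis.Analysis"
begin

unbundle cardinal_syntax

text \<open>
  An ordinal is represented by a well-order \<open>\<alpha>\<close>; the ordinals below it are the elements of
  \<^term>\<open>Field \<alpha>\<close>. Tuples of length \<open>n\<close> are extensional functions on \<^term>\<open>{..<n::nat}\<close>.
\<close>

definition cube :: "'i rel \<Rightarrow> ('i \<Rightarrow> real) set" where
  "cube \<alpha> = Field \<alpha> \<rightarrow>\<^sub>E {0..<1}"

definition increasing_tuple :: "'i rel \<Rightarrow> nat \<Rightarrow> (nat \<Rightarrow> 'i) \<Rightarrow> bool" where
  "increasing_tuple \<alpha> n k \<longleftrightarrow>
     (\<forall>i<n. k i \<in> Field \<alpha>) \<and> (\<forall>j<n. \<forall>i<j. (k i, k j) \<in> \<alpha> - Id)"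

definition cylinder :: "'i rel \<Rightarrow> nat \<Rightarrow> (nat \<Rightarrow> 'i) \<Rightarrow> (nat \<Rightarrow> real) set \<Rightarrow> ('i \<Rightarrow> real) set" where
  "cylinder \<alpha> n k A = {r \<in> cube \<alpha>. (\<lambda>i\<in>{..<n}. r (k i)) \<in> A}"

definition lebesgue_tuple :: "nat \<Rightarrow> (nat \<Rightarrow> real) measure" where
  "lebesgue_tuple n = completion (\<Pi>\<^sub>M i\<in>{..<n}. lborel)"

definition borel_cyl :: "'i rel \<Rightarrow> ('i \<Rightarrow> real) set set" where
  "borel_cyl \<alpha> = {cylinder \<alpha> n k A | n k A.
     increasing_tuple \<alpha> n k \<and> A \<subseteq> {..<n} \<rightarrow>\<^sub>E {0..<1} \<and> A \<in> sets (\<Pi>\<^sub>M i\<in>{..<n}. borel)}"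

definition lebesgue_cyl :: "'i rel \<Rightarrow> ('i \<Rightarrow> real) set set" where
  "lebesgue_cyl \<alpha> = {cylinder \<alpha> n k A | n k A.
     increasing_tuple \<alpha> n k \<and> A \<subseteq> {..<n} \<rightarrow>\<^sub>E {0..<1} \<and> A \<in> sets (lebesgue_tuple n)}"

text \<open>
  The measure is meaningful on \<^const>\<open>lebesgue_cyl\<close> only. There the description is unique, because
  two representations of a set as a cylinder can be compared over the union of their finitely
  many coordinates, where \<^term>\<open>{0..<1::real}\<close> has measure 1.
\<close>

definition cyl_measure :: "'i rel \<Rightarrow> ('i \<Rightarrow> real) set \<Rightarrow> ennreal" where
  "cyl_measure \<alpha> X = (THE c. \<exists>n k A.
     increasing_tuple \<alpha> n k \<and> A \<subseteq> {..<n} \<rightarrow>\<^sub>E {0..<1} \<and> A \<in> sets (lebesgue_tuple n) \<and>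
     X = cylinder \<alpha> n k A \<and> c = emeasure (lebesgue_tuple n) A)"

definition cylindrification :: "'i rel \<Rightarrow> 'i \<Rightarrow> ('i \<Rightarrow> real) set \<Rightarrow> ('i \<Rightarrow> real) set" where
  "cylindrification \<alpha> k a = {r \<in> cube \<alpha>. \<exists>u\<in>{0..<1}. r(k := u) \<in> a}"

definition dimension_set :: "'i rel \<Rightarrow> ('i \<Rightarrow> real) set \<Rightarrow> 'i set" where
  "dimension_set \<alpha> a = {k \<in> Field \<alpha>. cylindrification \<alpha> k a \<noteq> a}"

definition substitution :: "'i rel \<Rightarrow> ('i \<Rightarrow> real) set \<Rightarrow> 'i \<Rightarrow> 'i \<Rightarrow> ('i \<Rightarrow> real) set" where
  "substitution \<alpha> a k l = {r \<in> cube \<alpha>. r(k := r l) \<in> a}"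

definition section_through :: "('i \<Rightarrow> real) set \<Rightarrow> 'i \<Rightarrow> ('i \<Rightarrow> real) \<Rightarrow> real set" where
  "section_through a k r = {u \<in> {0..<1}. r(k := u) \<in> a}"

definition full_section :: "'i rel \<Rightarrow> 'i \<Rightarrow> ('i \<Rightarrow> real) set \<Rightarrow> ('i \<Rightarrow> real) set" where
  "full_section \<alpha> k a = {r \<in> cube \<alpha>. emeasure lebesgue (section_through a k r) = 1}"

end

theory Submission
  imports Defs "HOL-Probability.Infinite_Product_Measure"
begin

text \<open>
  On sets depending on finitely many coordinates, \<^const>\<open>cyl_measure\<close> is the product probability
  measure \<open>P\<close> on the cube. Let \<open>f r\<close> be the measure of the section of \<open>a\<close> through \<open>r\<close> in
  direction \<open>y\<close>. Resampling the coordinates \<open>y\<^sub>1, \<dots>, y\<^sub>n\<close>, on which neither \<open>a\<close> nor \<open>f\<close>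
  depends, shows that the \<open>n\<close>-fold intersection has measure \<open>\<integral> f\<^sup>n dP\<close>. Since \<open>f \<le> 1\<close>, these
  integrals decrease to \<open>P {f = 1}\<close> by monotone convergence.
\<close>

section \<open>Resampling one coordinate of a product probability space\<close>

lemma (in prob_space) measurable_PiM_upd:
  assumes "l \<in> I"
  shows "(\<lambda>(r, u). r(l := u)) \<in> (PiM I (\<lambda>_. M)) \<Otimes>\<^sub>M M \<rightarrow>\<^sub>M PiM I (\<lambda>_. M)"
  using measurable_add_dim[of l I "\<lambda>_. M"] assms by (simp add: insert_absorb)

text \<open>By Fubini the product splits into the factor at \<open>l\<close> and the product over
  \<open>I - {l}\<close>. The resampled integrand is constant in the old value at \<open>l\<close>,
  and integrating a constant against \<open>M\<close>, of mass 1, changes nothing.\<close>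

lemma (in prob_space) nn_integral_PiM_resample:
  assumes l: "l \<in> I" and h[measurable]: "h \<in> borel_measurable (PiM I (\<lambda>_. M))"
  shows "(\<integral>\<^sup>+r. h r \<partial>PiM I (\<lambda>_. M)) = (\<integral>\<^sup>+r. (\<integral>\<^sup>+u. h (r(l := u)) \<partial>M) \<partial>PiM I (\<lambda>_. M))"
proof -
  let ?P = "PiM I (\<lambda>_. M)" and ?Q = "PiM (I - {l}) (\<lambda>_. M)"
  have I: "insert l (I - {l}) = I"
    using l by auto
  interpret Q: prob_space ?Q
    by (intro prob_space_PiM prob_space_axioms)
  interpret QM: pair_sigma_finite M ?Q ..
  have P: "?P = distr (M \<Otimes>\<^sub>M ?Q) ?P (\<lambda>(x, X). X(l := x))"
    using distr_pair_PiM_eq_PiM[of "I - {l}" "\<lambda>_. M" l] prob_space_axioms unfolding I by simp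
  have "(\<lambda>(X, x). X(l := x)) \<in> ?Q \<Otimes>\<^sub>M M \<rightarrow>\<^sub>M ?P"
    using measurable_add_dim[of l "I - {l}" "\<lambda>_. M"] unfolding I .
  from measurable_compose[OF measurable_pair_swap' this]
  have upd[measurable]: "(\<lambda>(x, X). X(l := x)) \<in> M \<Otimes>\<^sub>M ?Q \<rightarrow>\<^sub>M ?P"
    by (simp add: split_beta)
  have split: "(\<integral>\<^sup>+r. g r \<partial>?P) = (\<integral>\<^sup>+X. (\<integral>\<^sup>+x. g (X(l := x)) \<partial>M) \<partial>?Q)"
    if g[measurable]: "g \<in> borel_measurable ?P" for g :: "('b \<Rightarrow> 'a) \<Rightarrow> ennreal"
  proof -
    have "(\<integral>\<^sup>+r. g r \<partial>?P) = (\<integral>\<^sup>+z. g (case z of (x, X) \<Rightarrow> X(l := x)) \<partial>(M \<Otimes>\<^sub>M ?Q))"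
      by (subst P, subst nn_integral_distr) auto
    also have "\<dots> = (\<integral>\<^sup>+X. (\<integral>\<^sup>+x. g (X(l := x)) \<partial>M) \<partial>?Q)"
      by (subst QM.nn_integral_snd[symmetric]) auto
    finally show ?thesis .
  qed
  have "(\<lambda>r. \<integral>\<^sup>+u. h (r(l := u)) \<partial>M) \<in> borel_measurable ?P"
    using measurable_compose[OF measurable_PiM_upd[OF l] h]
    by (intro borel_measurable_nn_integral) (simp add: split_beta)
  from split[OF this] have "(\<integral>\<^sup>+r. (\<integral>\<^sup>+u. h (r(l := u)) \<partial>M) \<partial>?P) =
      (\<integral>\<^sup>+X. (\<integral>\<^sup>+x. (\<integral>\<^sup>+u. h (X(l := u)) \<partial>M) \<partial>M) \<partial>?Q)"
    by simp
  also have "\<dots> = (\<integral>\<^sup>+r. h r \<partial>?P)"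
    by (simp add: split emeasure_space_1)
  finally show ?thesis ..
qed

section \<open>Sections and diagonal substitutions: measurability and integrals of powers\<close>

text \<open>The section is the slice at \<open>r\<close> of the preimage of \<open>a\<close> under
  the joint update map, so the measurability of slice measures applies.\<close>

lemma (in prob_space) measurable_emeasure_section_upd:
  assumes "y \<in> I" and a: "a \<in> sets (PiM I (\<lambda>_. M))"
  shows "(\<lambda>r. emeasure M {u \<in> space M. r(y := u) \<in> a}) \<in> borel_measurable (PiM I (\<lambda>_. M))"
proof -
  let ?P = "PiM I (\<lambda>_. M)"
  let ?Q = "(\<lambda>(r, u). r(y := u)) -` a \<inter> space (?P \<Otimes>\<^sub>M M)"
  have "?Q \<in> sets (?P \<Otimes>\<^sub>M M)"
    by (rule measurable_sets[OF measurable_PiM_upd[OF assms(1)] a])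
  then have "(\<lambda>r. emeasure M (Pair r -` ?Q)) \<in> borel_measurable ?P"
    by (rule measurable_emeasure_Pair)
  moreover have "Pair r -` ?Q = {u \<in> space M. r(y := u) \<in> a}" if "r \<in> space ?P" for r
    using that by (auto simp: space_pair_measure)
  ultimately show ?thesis
    by (simp cong: measurable_cong)
qed

lemma (in prob_space) section_upd_sets:
  assumes "y \<in> I" and a: "a \<in> sets (PiM I (\<lambda>_. M))" and "r \<in> space (PiM I (\<lambda>_. M))"
  shows "{u \<in> space M. r(y := u) \<in> a} \<in> sets M"
proof -
  have "(\<lambda>u. r(y := u)) \<in> M \<rightarrow>\<^sub>M PiM I (\<lambda>_. M)"
    using measurable_compose[OF measurable_Pair1'[OF assms(3)] measurable_PiM_upd[OF assms(1)]]
    by simp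
  from measurable_sets[OF this a] show ?thesis
    by (simp add: vimage_def Int_def conj_commute)
qed

lemma upd_space_PiM:
  "r \<in> space (PiM I (\<lambda>_. M)) \<Longrightarrow> l \<in> I \<Longrightarrow> u \<in> space M \<Longrightarrow> r(l := u) \<in> space (PiM I (\<lambda>_. M))"
  by (auto simp: space_PiM PiE_iff extensional_def)

text \<open>Substitution factors as the map from \<open>r\<close> to \<open>(r, r l)\<close>
  followed by the update at \<open>y\<close>.\<close>

lemma (in prob_space) sets_PiM_diagonal_substitution:
  assumes "y \<in> I" "l \<in> I" and a: "a \<in> sets (PiM I (\<lambda>_. M))"
  shows "{r \<in> space (PiM I (\<lambda>_. M)). r(y := r l) \<in> a} \<in> sets (PiM I (\<lambda>_. M))"
proof -
  let ?P = "PiM I (\<lambda>_. M)"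
  have "(\<lambda>r. (r, r l)) \<in> ?P \<rightarrow>\<^sub>M ?P \<Otimes>\<^sub>M M"
    using assms(2) by measurable
  from measurable_sets[OF measurable_compose[OF this measurable_PiM_upd[OF assms(1)]] a]
  show ?thesis
    by (simp add: vimage_def Int_def conj_commute)
qed

text \<open>The exponent \<open>m\<close> absorbs the substitutions already integrated out in the induction on \<open>n\<close>.\<close>

lemma (in prob_space) nn_integral_power_section_substitutions:
  fixes I :: "'i set" and ys :: "nat \<Rightarrow> 'i"
  defines "P \<equiv> PiM I (\<lambda>_. M)"
  assumes y: "y \<in> I" and a: "a \<in> sets P"
    and inj: "inj_on ys {1..}"
    and ys: "\<And>i. i \<ge> 1 \<Longrightarrow> ys i \<in> I - {y}"
    and indep: "\<And>i r u. i \<ge> 1 \<Longrightarrow> r \<in> space P \<Longrightarrow> u \<in> space M \<Longrightarrow> r(ys i := u) \<in> a \<longleftrightarrow> r \<in> a"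
  defines "f \<equiv> \<lambda>r. emeasure M {u \<in> space M. r(y := u) \<in> a}"
    and "S \<equiv> \<lambda>n. {r \<in> space P. \<forall>i\<in>{1..n}. r(y := r (ys i)) \<in> a}"
  shows "(\<integral>\<^sup>+r. f r ^ m * indicator (S n) r \<partial>P) = (\<integral>\<^sup>+r. f r ^ (m + n) \<partial>P)"
proof (induction n arbitrary: m)
  case 0
  show ?case
    by (auto intro!: nn_integral_cong simp: S_def)
next
  case (Suc n)
  \<comment> \<open>The last substitution coordinate is the one integrated out; the conditions for
    \<open>1..n\<close> are left to the induction hypothesis.\<close>
  define l where "l = ys (Suc n)"
  have l: "l \<in> I" "l \<noteq> y"
    using ys[of "Suc n"] by (auto simp: l_def)
  have upd: "r(l' := u) \<in> space P" if "r \<in> space P" "u \<in> space M" "l' \<in> I" for r u l'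
    using upd_space_PiM that by (metis P_def)
  have inda: "r(l := u) \<in> a \<longleftrightarrow> r \<in> a" if "r \<in> space P" "u \<in> space M" for r u
    using indep[of "Suc n"] that by (auto simp: l_def)
  have comp: "r i \<in> space M" if "r \<in> space P" "i \<in> I" for r i
    using that by (auto simp: P_def space_PiM)
  have fm[measurable]: "f \<in> borel_measurable P"
    unfolding f_def P_def using y a[unfolded P_def] by (rule measurable_emeasure_section_upd)
  have T: "{r \<in> space P. r(y := r (ys i)) \<in> a} \<in> sets P" if "i \<ge> 1" for i
    unfolding P_def using ys[OF that] y a[unfolded P_def]
    by (intro sets_PiM_diagonal_substitution) auto
  have Sm: "S k \<in> sets P" for k
    unfolding S_def by (intro sets.sets_Collect_finite_All T) auto
  note [measurable] = Sm
  \<comment> \<open>Since \<open>l \<noteq> y\<close>, the two updates commute, so sections in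
    direction \<open>y\<close> inherit from \<open>a\<close> the independence of
    \<open>l\<close>.\<close>
  have f_upd: "f (r(l := u)) = f r" if "r \<in> space P" "u \<in> space M" for r u
  proof -
    have "r(l := u, y := v) \<in> a \<longleftrightarrow> r(y := v) \<in> a" if "v \<in> space M" for v
      using inda[OF upd[OF \<open>r \<in> space P\<close> that y] \<open>u \<in> space M\<close>] l by (simp add: fun_upd_twist)
    then show ?thesis
      unfolding f_def by (intro arg_cong[where f="emeasure M"]) auto
  qed
  \<comment> \<open>Injectivity of \<open>ys\<close> keeps the earlier \<open>ys i\<close> away from
    \<open>l\<close>, so the value substituted for \<open>y\<close> is unaffected by the
    resampling.\<close>
  have S_upd: "r(l := u) \<in> S n \<longleftrightarrow> r \<in> S n" if r: "r \<in> space P" "u \<in> space M" for r u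
  proof -
    have "(r(l := u))(y := (r(l := u)) (ys i)) \<in> a \<longleftrightarrow> r(y := r (ys i)) \<in> a" if "i \<in> {1..n}" for i
    proof -
      have "ys i \<noteq> l"
        using inj_onD[OF inj, of i "Suc n"] that by (auto simp: l_def)
      moreover have "r (ys i) \<in> space M"
        using comp[OF r(1)] ys[of i] that by auto
      ultimately show ?thesis
        using inda[OF upd[OF r(1) \<open>r (ys i) \<in> space M\<close> y] r(2)] l by (simp add: fun_upd_twist)
    qed
    then show ?thesis
      using r l upd by (auto simp: S_def)
  qed
  \<comment> \<open>After resampling \<open>l\<close> to \<open>u\<close>, the last condition
    compares \<open>r(l := u, y := u)\<close> with \<open>a\<close>; dropping the update at
    \<open>l\<close> turns it into membership of \<open>u\<close> in the section through
    \<open>r\<close>.\<close>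
  have S_Suc: "r(l := u) \<in> S (Suc n) \<longleftrightarrow> r \<in> S n \<and> u \<in> {u \<in> space M. r(y := u) \<in> a}"
    if r: "r \<in> space P" "u \<in> space M" for r u
  proof -
    have "r(l := u) \<in> S (Suc n) \<longleftrightarrow> r(l := u) \<in> S n \<and> r(l := u, y := u) \<in> a"
      by (auto simp: S_def l_def atLeastAtMostSuc_conv)
    also have "r(l := u, y := u) \<in> a \<longleftrightarrow> r(y := u) \<in> a"
      using inda[OF upd[OF r y] r(2)] l by (simp add: fun_upd_twist)
    finally show ?thesis
      using S_upd[OF r] r(2) by blast
  qed
  have meas: "(\<lambda>r. f r ^ m * indicator (S (Suc n)) r) \<in> borel_measurable P"
    by measurable
  have "(\<integral>\<^sup>+r. f r ^ m * indicator (S (Suc n)) r \<partial>P) =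
      (\<integral>\<^sup>+r. (\<integral>\<^sup>+u. f (r(l := u)) ^ m * indicator (S (Suc n)) (r(l := u)) \<partial>M) \<partial>P)"
    using nn_integral_PiM_resample[OF l(1) meas[unfolded P_def]] by (simp add: P_def)
  also have "\<dots> = (\<integral>\<^sup>+r. (\<integral>\<^sup>+u. (f r ^ m * indicator (S n) r) *
      indicator {u \<in> space M. r(y := u) \<in> a} u \<partial>M) \<partial>P)"
    by (intro nn_integral_cong) (auto simp: f_upd S_Suc indicator_def)
  \<comment> \<open>The inner integral of the indicator is the section measure \<open>f r\<close>,
    which raises the exponent by one and removes the last condition.\<close>
  also have "\<dots> = (\<integral>\<^sup>+r. f r ^ Suc m * indicator (S n) r \<partial>P)"
  proof (intro nn_integral_cong)
    fix r assume "r \<in> space P"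
    then have "{u \<in> space M. r(y := u) \<in> a} \<in> sets M"
      using section_upd_sets[OF y] a unfolding P_def by blast
    then show "(\<integral>\<^sup>+u. (f r ^ m * indicator (S n) r) *
      indicator {u \<in> space M. r(y := u) \<in> a} u \<partial>M) = f r ^ Suc m * indicator (S n) r"
      by (subst nn_integral_cmult_indicator) (auto simp: f_def ac_simps)
  qed
  also have "\<dots> = (\<integral>\<^sup>+r. f r ^ (m + Suc n) \<partial>P)"
    using Suc.IH[of "Suc m"] by simp
  finally show ?case .
qed

section \<open>Decreasing limit of the integrals of powers\<close>

lemma INF_power_ennreal:
  fixes x :: ennreal
  assumes "x \<le> 1"
  shows "(INF n. x ^ n) = (if x = 1 then 1 else 0)"
proof (cases "x = 1")
  case False
  then obtain t where t: "x = ennreal t" "0 \<le> t" "t < 1"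
    using assms by (cases x) (auto simp: ennreal_less_iff less_le top_unique)
  then have "(\<lambda>n. ennreal (t ^ n)) \<longlonglongrightarrow> ennreal 0"
    by (intro tendsto_ennrealI LIMSEQ_realpow_zero)
  then have "(\<lambda>n. x ^ n) \<longlonglongrightarrow> 0"
    using t by (simp add: ennreal_power)
  moreover have "decseq (\<lambda>n. x ^ n)"
    using assms by (auto simp: decseq_def intro!: power_decreasing)
  then have "(\<lambda>n. x ^ n) \<longlonglongrightarrow> (INF n. x ^ n)"
    by (rule LIMSEQ_INF)
  ultimately show ?thesis
    using False LIMSEQ_unique by auto
qed auto

lemma (in prob_space) emeasure_full_section_eq_INF:
  fixes I :: "'i set" and ys :: "nat \<Rightarrow> 'i"
  defines "P \<equiv> PiM I (\<lambda>_. M)"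
  assumes y: "y \<in> I" and a: "a \<in> sets P"
    and inj: "inj_on ys {1..}"
    and ys: "\<And>i. i \<ge> 1 \<Longrightarrow> ys i \<in> I - {y}"
    and indep: "\<And>i r u. i \<ge> 1 \<Longrightarrow> r \<in> space P \<Longrightarrow> u \<in> space M \<Longrightarrow> r(ys i := u) \<in> a \<longleftrightarrow> r \<in> a"
  shows "emeasure P {r \<in> space P. emeasure M {u \<in> space M. r(y := u) \<in> a} = 1} =
    (INF n. emeasure P {r \<in> space P. \<forall>i\<in>{1..n}. r(y := r (ys i)) \<in> a})"
proof -
  define f where "f = (\<lambda>r. emeasure M {u \<in> space M. r(y := u) \<in> a})"
  define S where "S = (\<lambda>n. {r \<in> space P. \<forall>i\<in>{1..n}. r(y := r (ys i)) \<in> a})"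
  interpret P: prob_space P
    unfolding P_def by (intro prob_space_PiM prob_space_axioms)
  have fm[measurable]: "f \<in> borel_measurable P"
    unfolding f_def P_def using y a[unfolded P_def] by (rule measurable_emeasure_section_upd)
  have f1: "f r \<le> 1" for r
    by (simp add: f_def emeasure_le_1)
  have T: "{r \<in> space P. r(y := r (ys i)) \<in> a} \<in> sets P" if "i \<ge> 1" for i
    unfolding P_def using ys[OF that] y a[unfolded P_def]
    by (intro sets_PiM_diagonal_substitution) auto
  have Sm: "S k \<in> sets P" for k
    unfolding S_def by (intro sets.sets_Collect_finite_All T) auto
  \<comment> \<open>With exponent \<open>m = 0\<close> the integrand is just the indicator of
    \<open>S n\<close>.\<close>
  have "emeasure P (S n) = (\<integral>\<^sup>+r. f r ^ n \<partial>P)" for n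
    using nn_integral_power_section_substitutions[of y I a ys 0 n, folded P_def, OF y a inj ys indep]
      Sm[of n] unfolding S_def f_def by simp
  then have "(INF n. emeasure P (S n)) = (INF n. \<integral>\<^sup>+r. f r ^ n \<partial>P)"
    by simp
  also have "\<dots> = (\<integral>\<^sup>+r. (INF n. f r ^ n) \<partial>P)"
  \<comment> \<open>Monotone convergence for a decreasing sequence needs a finite integral; at
    exponent 0 the integrand is constantly 1.\<close>
  proof (rule nn_integral_monotone_convergence_INF_decseq[symmetric])
    show "decseq (\<lambda>n r. f r ^ n)"
      using f1 by (auto simp: monotone_def le_fun_def intro!: power_decreasing)
    show "(\<integral>\<^sup>+r. f r ^ 0 \<partial>P) < \<infinity>"
      by (simp add: P.emeasure_space_1)
  qed measurable
  also have "\<dots> = (\<integral>\<^sup>+r. indicator {r \<in> space P. f r = 1} r \<partial>P)"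
    by (intro nn_integral_cong) (simp add: INF_power_ennreal[OF f1])
  also have "\<dots> = emeasure P {r \<in> space P. f r = 1}"
    by (intro nn_integral_indicator) measurable
  finally show ?thesis
    unfolding f_def S_def ..
qed

section \<open>Uniform measure on [0,1) and its powers\<close>

text \<open>Restricting the space itself to [0,1) gives a probability measure, whose product exists
  over an arbitrary index set.\<close>

definition unit_lborel :: "real measure" where
  "unit_lborel = restrict_space lborel {0..<1}"

abbreviation cube_measure :: "'i rel \<Rightarrow> ('i \<Rightarrow> real) measure" where
  "cube_measure \<alpha> \<equiv> PiM (Field \<alpha>) (\<lambda>_. unit_lborel)"

text \<open>A description of cylinders over \<open>F\<close> that needs neither an enumeration of
  \<open>F\<close> nor a base.\<close>

definition depends_on :: "'i rel \<Rightarrow> 'i set \<Rightarrow> ('i \<Rightarrow> real) set \<Rightarrow> bool" where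
  "depends_on \<alpha> F X \<longleftrightarrow>
     (\<forall>r\<in>cube \<alpha>. \<forall>s\<in>cube \<alpha>. (\<forall>i\<in>F. r i = s i) \<longrightarrow> (r \<in> X \<longleftrightarrow> s \<in> X))"

lemma space_unit_lborel [simp]: "space unit_lborel = {0..<1}"
  by (simp add: unit_lborel_def space_restrict_space)

lemma sets_unit_lborel: "A \<in> sets unit_lborel \<longleftrightarrow> A \<subseteq> {0..<1} \<and> A \<in> sets borel"
  by (auto simp: unit_lborel_def sets_restrict_space_iff)

lemma emeasure_unit_lborel: "A \<subseteq> {0..<1} \<Longrightarrow> emeasure unit_lborel A = emeasure lborel A"
  unfolding unit_lborel_def by (intro emeasure_restrict_space) auto

lemma prob_space_unit_lborel: "prob_space unit_lborel"
  by (rule prob_spaceI) (simp add: emeasure_unit_lborel)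

lemma measurable_unit_lborel_lborel: "(\<lambda>x. x) \<in> unit_lborel \<rightarrow>\<^sub>M lborel"
  unfolding unit_lborel_def by (rule measurable_restrict_space1) simp

text \<open>The two sigma-algebras are compared by pulling back along measurable maps: a retraction
  of the full space onto the cube in one direction, the inclusion of the cube in the other.\<close>

lemma sets_PiM_unit_lborel:
  assumes "finite J"
  shows "A \<in> sets (PiM J (\<lambda>_. unit_lborel)) \<longleftrightarrow>
    A \<subseteq> (J \<rightarrow>\<^sub>E {0..<1}) \<and> A \<in> sets (PiM J (\<lambda>_. lborel))"
proof (intro iffI conjI; (elim conjE)?)
  let ?U = "PiM J (\<lambda>_. unit_lborel)" and ?B = "PiM J (\<lambda>_. lborel :: real measure)"
  \<comment> \<open>The retraction sends coordinates outside [0,1) to the arbitrary value 0; points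
    moved by it are later discarded by intersecting with the cube.\<close>
  let ?clip = "\<lambda>t. \<lambda>i\<in>J. if t i \<in> {0..<1} then t i else (0::real)"
  assume A: "A \<in> sets ?U"
  from sets.sets_into_space[OF this] show sub: "A \<subseteq> (J \<rightarrow>\<^sub>E {0..<1})"
    by (simp add: space_PiM)
  have "(\<lambda>x. if x \<in> {0..<1} then x else 0) \<in> lborel \<rightarrow>\<^sub>M unit_lborel"
    unfolding unit_lborel_def by (intro measurable_restrict_space2) auto
  then have "?clip \<in> ?B \<rightarrow>\<^sub>M ?U"
    by (intro measurable_restrict measurable_compose[OF measurable_component_singleton])
  moreover have "(J \<rightarrow>\<^sub>E {0..<1}) \<in> sets ?B"
    using assms by (intro sets_PiM_I_finite) auto
  ultimately have "(?clip -` A \<inter> space ?B) \<inter> (J \<rightarrow>\<^sub>E {0..<1}) \<in> sets ?B"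
    using A by (intro sets.Int measurable_sets)
  also have "(?clip -` A \<inter> space ?B) \<inter> (J \<rightarrow>\<^sub>E {0..<1}) = A"
  proof -
    have "?clip t = t" if "t \<in> J \<rightarrow>\<^sub>E {0..<1}" for t
    proof
      fix i show "?clip t i = t i"
        using that by (cases "i \<in> J") (auto simp: PiE_iff extensional_def)
    qed
    then show ?thesis
      using sub by (auto simp: space_PiM)
  qed
  finally show "A \<in> sets ?B" .
next
  let ?U = "PiM J (\<lambda>_. unit_lborel)" and ?B = "PiM J (\<lambda>_. lborel :: real measure)"
  assume A: "A \<subseteq> (J \<rightarrow>\<^sub>E {0..<1})" "A \<in> sets ?B"
  have "(\<lambda>t. \<lambda>i\<in>J. t i) \<in> ?U \<rightarrow>\<^sub>M ?B"
    by (intro measurable_restrict measurable_compose[OF measurable_component_singleton]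
        measurable_unit_lborel_lborel)
  from measurable_sets[OF this A(2)] have "(\<lambda>t. \<lambda>i\<in>J. t i) -` A \<inter> space ?U \<in> sets ?U" .
  also have "(\<lambda>t. \<lambda>i\<in>J. t i) -` A \<inter> space ?U = A"
    using A(1) by (auto simp: space_PiM)
  finally show "A \<in> sets ?U" .
qed

text \<open>Restricted to the cube, the product of \<open>lborel\<close> takes the product values on
  boxes, which characterizes the finite product of \<open>unit_lborel\<close>.\<close>

lemma emeasure_PiM_unit_lborel:
  assumes J: "finite J" and A: "A \<in> sets (PiM J (\<lambda>_. unit_lborel))"
  shows "emeasure (PiM J (\<lambda>_. unit_lborel)) A = emeasure (PiM J (\<lambda>_. lborel)) A"
proof -
  let ?U = "PiM J (\<lambda>_. unit_lborel)" and ?B = "PiM J (\<lambda>_. lborel :: real measure)"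
  let ?C = "J \<rightarrow>\<^sub>E {0..<1::real}"
  interpret U: prob_space unit_lborel
    by (rule prob_space_unit_lborel)
  interpret U: product_sigma_finite "\<lambda>_. unit_lborel" ..
  interpret B: product_sigma_finite "\<lambda>_. lborel :: real measure" ..
  have C: "?C \<in> sets ?B"
    using J by (intro sets_PiM_I_finite) auto
  have "restrict_space ?B ?C = ?U"
  proof (rule U.PiM_eqI[OF J])
    show "sets (restrict_space ?B ?C) = sets ?U"
      using C by (auto simp: sets_restrict_space_iff sets_PiM_unit_lborel[OF J])
    fix E assume E: "\<And>i. i \<in> J \<Longrightarrow> E i \<in> sets unit_lborel"
    then have "Pi\<^sub>E J E \<subseteq> ?C"
      by (intro PiE_mono) (simp add: sets_unit_lborel)
    then have "emeasure (restrict_space ?B ?C) (Pi\<^sub>E J E) = emeasure ?B (Pi\<^sub>E J E)"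
      using C by (intro emeasure_restrict_space) auto
    also have "\<dots> = (\<Prod>i\<in>J. emeasure lborel (E i))"
      using E J by (intro B.emeasure_PiM) (auto simp: sets_unit_lborel)
    also have "\<dots> = (\<Prod>i\<in>J. emeasure unit_lborel (E i))"
      using E by (intro prod.cong refl) (simp add: sets_unit_lborel emeasure_unit_lborel)
    finally show "emeasure (restrict_space ?B ?C) (Pi\<^sub>E J E) =
      (\<Prod>i\<in>J. emeasure unit_lborel (E i))" .
  qed
  then have "emeasure ?U A = emeasure (restrict_space ?B ?C) A"
    by simp
  also have "\<dots> = emeasure ?B A"
    using C A by (intro emeasure_restrict_space) (auto simp: sets_PiM_unit_lborel[OF J])
  finally show ?thesis .
qed

section \<open>Cylinders: measurability, probability and uniqueness of their measure\<close>

lemma space_cube_measure: "space (cube_measure \<alpha>) = cube \<alpha>"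
  by (simp add: space_PiM cube_def)

lemma increasing_tuple_Field: "increasing_tuple \<alpha> n k \<Longrightarrow> i < n \<Longrightarrow> k i \<in> Field \<alpha>"
  by (simp add: increasing_tuple_def)

lemma increasing_tuple_inj_on: "increasing_tuple \<alpha> n k \<Longrightarrow> inj_on k {..<n}"
  unfolding increasing_tuple_def inj_on_def
  by (metis Diff_iff IdI lessThan_iff linorder_neqE_nat)

text \<open>A cylinder is the preimage of its base under projection to the coordinates
  \<open>k\<close>. As \<open>k\<close> is injective, this projection pushes the product measure
  forward to the \<open>n\<close>-fold product.\<close>

lemma
  assumes k: "increasing_tuple \<alpha> n k" and A: "A \<in> sets (PiM {..<n} (\<lambda>_. unit_lborel))"
  shows sets_cube_measure_cylinder: "cylinder \<alpha> n k A \<in> sets (cube_measure \<alpha>)"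
    and emeasure_cube_measure_cylinder: "emeasure (cube_measure \<alpha>) (cylinder \<alpha> n k A) =
      emeasure (PiM {..<n} (\<lambda>_. unit_lborel)) A"
proof -
  let ?U = "PiM {..<n} (\<lambda>_. unit_lborel)" and ?p = "\<lambda>r. \<lambda>i\<in>{..<n}. r (k i)"
  have kF: "k i \<in> Field \<alpha>" if "i < n" for i
    using increasing_tuple_Field[OF k that] .
  have p: "?p \<in> cube_measure \<alpha> \<rightarrow>\<^sub>M ?U"
    using kF by (intro measurable_restrict measurable_component_singleton) auto
  have cyl: "cylinder \<alpha> n k A = ?p -` A \<inter> space (cube_measure \<alpha>)"
    by (auto simp: cylinder_def space_cube_measure)
  show "cylinder \<alpha> n k A \<in> sets (cube_measure \<alpha>)"
    unfolding cyl by (rule measurable_sets[OF p A])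
  have "distr (cube_measure \<alpha>) ?U ?p = ?U"
    using distr_PiM_reindex[of "Field \<alpha>" "\<lambda>_. unit_lborel" k "{..<n}"]
      increasing_tuple_inj_on[OF k] kF prob_space_unit_lborel by auto
  then show "emeasure (cube_measure \<alpha>) (cylinder \<alpha> n k A) = emeasure ?U A"
    unfolding cyl using emeasure_distr[OF p A] by simp
qed

text \<open>
  Borel approximation transfers the uniqueness of the measure of a cylinder from Borel to
  Lebesgue measurable bases.
\<close>

lemma lebesgue_tuple_sandwich:
  assumes A: "A \<subseteq> {..<n} \<rightarrow>\<^sub>E {0..<1}" "A \<in> sets (lebesgue_tuple n)"
  obtains B C where "B \<in> sets (PiM {..<n} (\<lambda>_. unit_lborel))"
    and "C \<in> sets (PiM {..<n} (\<lambda>_. unit_lborel))" and "B \<subseteq> A" and "A \<subseteq> C"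
    and "emeasure (PiM {..<n} (\<lambda>_. unit_lborel)) B = emeasure (lebesgue_tuple n) A"
    and "emeasure (PiM {..<n} (\<lambda>_. unit_lborel)) C = emeasure (lebesgue_tuple n) A"
proof -
  let ?B = "PiM {..<n} (\<lambda>_. lborel :: real measure)" and ?E = "{..<n} \<rightarrow>\<^sub>E {0..<1::real}"
  have A': "A \<in> sets (completion ?B)"
    using A(2) by (simp add: lebesgue_tuple_def)
  \<comment> \<open>A measurable hull of \<open>A\<close>. Cutting it down to the cube keeps it
    above \<open>A\<close>, hence keeps its measure, and makes it measurable for the product of
    \<open>unit_lborel\<close>.\<close>
  obtain C where C: "C \<in> sets ?B" "A \<subseteq> C" "emeasure (completion ?B) A = emeasure ?B C"
    using completion_upper[OF A'] by blast
  have E: "?E \<in> sets ?B"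
    by (intro sets_PiM_I_finite) auto
  have "emeasure (completion ?B) A \<le> emeasure (completion ?B) (C \<inter> ?E)"
    using C E A by (intro emeasure_mono) auto
  also have "emeasure (completion ?B) (C \<inter> ?E) = emeasure ?B (C \<inter> ?E)"
    using C E by (simp add: sets.Int)
  finally have "emeasure (completion ?B) A = emeasure ?B (C \<inter> ?E)"
    unfolding C(3) by (rule antisym) (use C(1) in \<open>auto intro!: emeasure_mono\<close>)
  moreover have "C \<inter> ?E \<in> sets (PiM {..<n} (\<lambda>_. unit_lborel))"
    using C E by (simp add: sets_PiM_unit_lborel sets.Int)
  \<comment> \<open>The inner approximation is the measurable part of \<open>A\<close> in the
    completion, what remains being negligible.\<close>
  moreover have "main_part ?B A \<subseteq> A"
    using main_part_null_part_Un[OF A'] by blast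
  moreover from this have "main_part ?B A \<in> sets (PiM {..<n} (\<lambda>_. unit_lborel))"
    using A(1) A' by (auto simp: sets_PiM_unit_lborel)
  moreover have "emeasure (completion ?B) A = emeasure ?B (main_part ?B A)"
    using A' by (rule emeasure_completion)
  ultimately show thesis
    using A C(2) by (intro that[of "main_part ?B A" "C \<inter> ?E"])
      (simp_all add: emeasure_PiM_unit_lborel lebesgue_tuple_def del: emeasure_completion)
qed

lemma cylinder_mono: "A \<subseteq> B \<Longrightarrow> cylinder \<alpha> n k A \<subseteq> cylinder \<alpha> n k B"
  by (auto simp: cylinder_def)

text \<open>This justifies the definite description: any two representations of a set assign it the
  same value, by an inequality applied in both directions.\<close>

lemma cyl_measure_cylinder:
  assumes k: "increasing_tuple \<alpha> n k"
    and A: "A \<subseteq> {..<n} \<rightarrow>\<^sub>E {0..<1}" "A \<in> sets (lebesgue_tuple n)"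
  shows "cyl_measure \<alpha> (cylinder \<alpha> n k A) = emeasure (lebesgue_tuple n) A"
proof -
  \<comment> \<open>A Borel set inside \<open>A\<close> and one around \<open>B\<close>, each of the
    same measure as the set it approximates, span nested cylinders. Both are measured by
    \<open>cube_measure\<close>, so the two coordinate tuples need not be merged.\<close>
  have le: "emeasure (lebesgue_tuple n) A \<le> emeasure (lebesgue_tuple m) B"
    if k: "increasing_tuple \<alpha> n k"
      and A: "A \<subseteq> {..<n} \<rightarrow>\<^sub>E {0..<1}" "A \<in> sets (lebesgue_tuple n)"
      and l: "increasing_tuple \<alpha> m l"
      and B: "B \<subseteq> {..<m} \<rightarrow>\<^sub>E {0..<1}" "B \<in> sets (lebesgue_tuple m)"
      and eq: "cylinder \<alpha> n k A = cylinder \<alpha> m l B" for n m k l A B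
  proof -
    obtain A' where A': "A' \<in> sets (PiM {..<n} (\<lambda>_. unit_lborel))" "A' \<subseteq> A"
      "emeasure (PiM {..<n} (\<lambda>_. unit_lborel)) A' = emeasure (lebesgue_tuple n) A"
      using lebesgue_tuple_sandwich[OF A] by metis
    obtain B' where B': "B' \<in> sets (PiM {..<m} (\<lambda>_. unit_lborel))" "B \<subseteq> B'"
      "emeasure (PiM {..<m} (\<lambda>_. unit_lborel)) B' = emeasure (lebesgue_tuple m) B"
      using lebesgue_tuple_sandwich[OF B] by metis
    have "cylinder \<alpha> n k A' \<subseteq> cylinder \<alpha> m l B'"
      using cylinder_mono[OF A'(2)] cylinder_mono[OF B'(2)] eq by blast
    then have "emeasure (cube_measure \<alpha>) (cylinder \<alpha> n k A') \<le>
        emeasure (cube_measure \<alpha>) (cylinder \<alpha> m l B')"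
      by (intro emeasure_mono sets_cube_measure_cylinder[OF l B'(1)])
    then show ?thesis
      by (simp add: emeasure_cube_measure_cylinder[OF k A'(1)]
          emeasure_cube_measure_cylinder[OF l B'(1)] A'(3) B'(3))
  qed
  show ?thesis
    unfolding cyl_measure_def
  proof (rule the_equality)
    show "\<exists>n' k' A'. increasing_tuple \<alpha> n' k' \<and> A' \<subseteq> {..<n'} \<rightarrow>\<^sub>E {0..<1} \<and>
        A' \<in> sets (lebesgue_tuple n') \<and> cylinder \<alpha> n k A = cylinder \<alpha> n' k' A' \<and>
        emeasure (lebesgue_tuple n) A = emeasure (lebesgue_tuple n') A'"
      using k A by blast
  next
    fix c
    assume "\<exists>n' k' A'. increasing_tuple \<alpha> n' k' \<and> A' \<subseteq> {..<n'} \<rightarrow>\<^sub>E {0..<1} \<and>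
        A' \<in> sets (lebesgue_tuple n') \<and> cylinder \<alpha> n k A = cylinder \<alpha> n' k' A' \<and>
        c = emeasure (lebesgue_tuple n') A'"
    then obtain n' k' A' where *: "increasing_tuple \<alpha> n' k'" "A' \<subseteq> {..<n'} \<rightarrow>\<^sub>E {0..<1}"
        "A' \<in> sets (lebesgue_tuple n')" "cylinder \<alpha> n k A = cylinder \<alpha> n' k' A'"
        "c = emeasure (lebesgue_tuple n') A'"
      by blast
    show "c = emeasure (lebesgue_tuple n) A"
      unfolding *(5)
      by (intro antisym le[OF *(1-3) k A *(4)[symmetric]] le[OF k A *(1-4)])
  qed
qed

section \<open>Measure of sets depending on finitely many coordinates\<close>

lemma increasing_tuple_enumeration:
  assumes \<alpha>: "Well_order \<alpha>" and F: "finite F" "F \<subseteq> Field \<alpha>"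
  obtains n k where "increasing_tuple \<alpha> n k" "bij_betw k {..<n} F"
proof -
  have total: "x = z \<or> (x, z) \<in> \<alpha> \<or> (z, x) \<in> \<alpha>" if "x \<in> F" "z \<in> F" for x z
    using \<alpha> that F by (auto simp: order_on_defs total_on_def)
  have trans: "trans \<alpha>" and antisym: "antisym \<alpha>"
    using \<alpha> by (auto simp: order_on_defs)
  \<comment> \<open>The position of \<open>x\<close> is the number of its strict predecessors in
    \<open>F\<close>. This is strictly monotone, hence a bijection onto \<open>{..<card F}\<close>,
    and its inverse is the required enumeration.\<close>
  define rank where "rank x = card {z \<in> F. (z, x) \<in> \<alpha> - Id}" for x
  have rank_less: "rank x < rank z" if "x \<in> F" "(x, z) \<in> \<alpha> - Id" for x z
  proof -
    have "{w \<in> F. (w, x) \<in> \<alpha> - Id} \<subset> {w \<in> F. (w, z) \<in> \<alpha> - Id}"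
      using that transD[OF trans] antisymD[OF antisym] by blast
    then show ?thesis
      unfolding rank_def using F(1) by (intro psubset_card_mono) auto
  qed
  have inj: "inj_on rank F"
    using rank_less total by (intro inj_onI) (metis DiffI less_irrefl pair_in_Id_conv)
  have "rank x < card F" if "x \<in> F" for x
    unfolding rank_def using F(1) that by (intro psubset_card_mono) auto
  then have "rank ` F \<subseteq> {..<card F}"
    by auto
  then have "rank ` F = {..<card F}"
    by (intro card_subset_eq) (auto simp: card_image inj)
  then have bij: "bij_betw (the_inv_into F rank) {..<card F} F"
    using inj by (intro bij_betw_the_inv_into) (simp add: bij_betw_def)
  let ?k = "the_inv_into F rank"
  have k: "?k i \<in> F" "rank (?k i) = i" if "i < card F" for i
    using that bij \<open>rank ` F = {..<card F}\<close> f_the_inv_into_f[OF inj, of i]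
    by (auto dest: bij_betwE)
  have "(?k i, ?k j) \<in> \<alpha> - Id" if "j < card F" "i < j" for i j
  proof -
    have i: "i < card F"
      using that by simp
    have "?k i \<noteq> ?k j"
      using k(2)[OF i] k(2)[OF that(1)] that(2) by auto
    moreover have "(?k j, ?k i) \<notin> \<alpha> - Id"
      using rank_less[OF k(1)[OF that(1)], of "?k i"] k(2)[OF i] k(2)[OF that(1)] that(2) by auto
    ultimately show ?thesis
      using total[OF k(1)[OF i] k(1)[OF that(1)]] by auto
  qed
  then have "increasing_tuple \<alpha> (card F) ?k"
    using k(1) F(2) by (auto simp: increasing_tuple_def)
  with bij show thesis
    by (intro that)
qed

text \<open>A Borel base for \<open>X\<close> is obtained by pulling \<open>X\<close> back along an
  extension of \<open>n\<close>-tuples to points of the cube; dependence on \<open>F\<close> alone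
  makes \<open>X\<close> the cylinder over that base.\<close>

lemma cyl_measure_eq_cube_measure:
  assumes \<alpha>: "Well_order \<alpha>" and F: "finite F" "F \<subseteq> Field \<alpha>"
    and X: "X \<in> sets (cube_measure \<alpha>)" and dep: "depends_on \<alpha> F X"
  shows "cyl_measure \<alpha> X = emeasure (cube_measure \<alpha>) X"
proof -
  obtain n k where k: "increasing_tuple \<alpha> n k" and bij: "bij_betw k {..<n} F"
    using increasing_tuple_enumeration[OF \<alpha> F] .
  let ?U = "PiM {..<n} (\<lambda>_. unit_lborel)"
  \<comment> \<open>Coordinates in \<open>F\<close> are read from the tuple through the inverse of
    \<open>k\<close>. The default 0 elsewhere only has to lie in [0,1), since \<open>X\<close>
    ignores those coordinates.\<close>
  define ext where "ext t = (\<lambda>i\<in>Field \<alpha>. if i \<in> F then t (the_inv_into {..<n} k i) else 0)"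
    for t :: "nat \<Rightarrow> real"
  have inv: "the_inv_into {..<n} k i < n" if "i \<in> F" for i
    using bij_betwE[OF bij_betw_the_inv_into[OF bij]] that by auto
  have inv_k: "the_inv_into {..<n} k (k i) = i" if "i < n" for i
    using that bij by (simp add: bij_betw_def the_inv_into_f_f)
  have k_inv: "k (the_inv_into {..<n} k i) = i" if "i \<in> F" for i
    using that bij by (simp add: bij_betw_def f_the_inv_into_f)
  have ext_m: "ext \<in> ?U \<rightarrow>\<^sub>M cube_measure \<alpha>"
    unfolding ext_def
  proof (rule measurable_restrict)
    fix i
    show "(\<lambda>t. if i \<in> F then t (the_inv_into {..<n} k i) else 0) \<in> ?U \<rightarrow>\<^sub>M unit_lborel"
      using inv by (cases "i \<in> F") (auto intro!: measurable_component_singleton)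
  qed
  define A where "A = ext -` X \<inter> space ?U"
  have A: "A \<in> sets ?U"
    unfolding A_def by (rule measurable_sets[OF ext_m X])
  then have A': "A \<subseteq> {..<n} \<rightarrow>\<^sub>E {0..<1}" "A \<in> sets (PiM {..<n} (\<lambda>_. lborel))"
    by (simp_all add: sets_PiM_unit_lborel)
  have "X = cylinder \<alpha> n k A"
  proof -
    have "r \<in> X \<longleftrightarrow> (\<lambda>i\<in>{..<n}. r (k i)) \<in> A" if r: "r \<in> cube \<alpha>" for r
    proof -
      let ?t = "\<lambda>i\<in>{..<n}. r (k i)"
      have t: "?t \<in> space ?U"
        using r increasing_tuple_Field[OF k] by (auto simp: space_PiM cube_def)
      then have "ext ?t \<in> cube \<alpha>"
        using measurable_space[OF ext_m] by (simp add: space_cube_measure)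
      moreover have "\<forall>i\<in>F. r i = ext ?t i"
        using inv k_inv F(2) by (auto simp: ext_def)
      ultimately have "r \<in> X \<longleftrightarrow> ext ?t \<in> X"
        using dep r unfolding depends_on_def by blast
      with t show ?thesis
        by (simp add: A_def)
    qed
    then show ?thesis
      using sets.sets_into_space[OF X] by (auto simp: cylinder_def space_cube_measure)
  qed
  then have "cyl_measure \<alpha> X = emeasure (lebesgue_tuple n) A"
    using A' by (simp add: cyl_measure_cylinder[OF k] lebesgue_tuple_def)
  \<comment> \<open>The base is measurable before completion, so the completed measure agrees with
    the product measure on it.\<close>
  also have "\<dots> = emeasure ?U A"
    using A' by (simp add: lebesgue_tuple_def emeasure_PiM_unit_lborel[OF _ A])
  also have "\<dots> = emeasure (cube_measure \<alpha>) X"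
    using emeasure_cube_measure_cylinder[OF k A] \<open>X = cylinder \<alpha> n k A\<close> by simp
  finally show ?thesis .
qed

section \<open>Borel cylinders, dimension sets and the infimum formula\<close>

lemma cube_upd: "r \<in> cube \<alpha> \<Longrightarrow> l \<in> Field \<alpha> \<Longrightarrow> u \<in> {0..<1} \<Longrightarrow> r(l := u) \<in> cube \<alpha>"
  by (auto simp: cube_def PiE_iff extensional_def)

lemma borel_cyl_depends_on:
  assumes "a \<in> borel_cyl \<alpha>"
  obtains F where "finite F" "F \<subseteq> Field \<alpha>" "depends_on \<alpha> F a" "a \<in> sets (cube_measure \<alpha>)"
proof -
  obtain n k A where a: "a = cylinder \<alpha> n k A" and k: "increasing_tuple \<alpha> n k"
    and A: "A \<subseteq> {..<n} \<rightarrow>\<^sub>E {0..<1}" "A \<in> sets (PiM {..<n} (\<lambda>_. borel))"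
    using assms unfolding borel_cyl_def by blast
  have "sets (PiM {..<n} (\<lambda>_. borel :: real measure)) = sets (PiM {..<n} (\<lambda>_. lborel))"
    by (intro sets_PiM_cong) auto
  then have "A \<in> sets (PiM {..<n} (\<lambda>_. unit_lborel))"
    using A by (simp add: sets_PiM_unit_lborel)
  then have "a \<in> sets (cube_measure \<alpha>)"
    unfolding a by (rule sets_cube_measure_cylinder[OF k])
  moreover have "depends_on \<alpha> (k ` {..<n}) a"
    unfolding depends_on_def
  proof (intro ballI impI)
    fix r s assume rs: "r \<in> cube \<alpha>" "s \<in> cube \<alpha>" "\<forall>i\<in>k ` {..<n}. r i = s i"
    then have "(\<lambda>i\<in>{..<n}. r (k i)) = (\<lambda>i\<in>{..<n}. s (k i))"
      by (intro restrict_ext) auto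
    then show "r \<in> a \<longleftrightarrow> s \<in> a"
      using rs unfolding a cylinder_def by simp
  qed
  ultimately show thesis
    using increasing_tuple_Field[OF k] by (intro that[of "k ` {..<n}"]) auto
qed

text \<open>Cylindrification at \<open>l\<close> fixes \<open>a\<close>. The value \<open>u\<close>
  witnesses one direction; for the other, the old value \<open>r l\<close> restores \<open>r\<close>
  from \<open>r(l := u)\<close>.\<close>

lemma upd_outside_dimension_set:
  assumes l: "l \<in> Field \<alpha> - dimension_set \<alpha> a"
    and r: "r \<in> cube \<alpha>" and u: "u \<in> {0..<1}"
  shows "r(l := u) \<in> a \<longleftrightarrow> r \<in> a"
proof
  have C: "cylindrification \<alpha> l a = a"
    using l by (auto simp: dimension_set_def)
  show "r \<in> a" if "r(l := u) \<in> a"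
    using that r u by (subst C[symmetric]) (auto simp: cylindrification_def)
  have "r l \<in> {0..<1}"
    using r l by (auto simp: cube_def)
  then show "r(l := u) \<in> a" if "r \<in> a"
    using that cube_upd[OF r _ u] l
    by (subst C[symmetric]) (auto simp: cylindrification_def intro!: bexI[of _ "r l"])
qed

theorem theorem6:
  fixes \<alpha> :: "'i rel" and a :: "('i \<Rightarrow> real) set" and y :: 'i and ys :: "nat \<Rightarrow> 'i"
  assumes "Well_order \<alpha>" and "natLeq \<le>o \<alpha>"
    and "a \<in> borel_cyl \<alpha>"
    and "y \<in> dimension_set \<alpha> a"
    and "inj_on ys {1..}"
    and "\<And>i. i \<ge> 1 \<Longrightarrow> ys i \<in> Field \<alpha> - dimension_set \<alpha> a"
  shows "cyl_measure \<alpha> (full_section \<alpha> y a) =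
    (INF n. cyl_measure \<alpha> (cube \<alpha> \<inter> (\<Inter>i\<in>{1..n}. substitution \<alpha> a y (ys i))))"
proof -
  interpret prob_space unit_lborel
    by (rule prob_space_unit_lborel)
  obtain F where F: "finite F" "F \<subseteq> Field \<alpha>" and dep: "depends_on \<alpha> F a"
    and a: "a \<in> sets (cube_measure \<alpha>)"
    using borel_cyl_depends_on[OF assms(3)] .
  have y: "y \<in> Field \<alpha>"
    using assms(4) by (simp add: dimension_set_def)
  \<comment> \<open>\<open>y\<close> lies in the dimension set and \<open>ys i\<close> does not, so
    they differ.\<close>
  have ys: "ys i \<in> Field \<alpha> - {y}" if "i \<ge> 1" for i
    using assms(6)[OF that] assms(4) by auto
  let ?S = "\<lambda>n. {r \<in> cube \<alpha>. \<forall>i\<in>{1..n}. r(y := r (ys i)) \<in> a}"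
  let ?f = "\<lambda>r. emeasure unit_lborel {u \<in> {0..<1}. r(y := u) \<in> a}"
  have dep_upd: "r(y := u) \<in> a \<longleftrightarrow> s(y := u) \<in> a"
    if "r \<in> cube \<alpha>" "s \<in> cube \<alpha>" "\<forall>i\<in>F. r i = s i" "u \<in> {0..<1}" for r s u
    using that(3)
    by (intro dep[unfolded depends_on_def, rule_format] cube_upd that(1,2,4) y) simp
  \<comment> \<open>For \<open>n = 0\<close> the intersection over the empty index set is the whole
    type, and intersecting with the cube leaves the cube.\<close>
  have S_eq: "cube \<alpha> \<inter> (\<Inter>i\<in>{1..n}. substitution \<alpha> a y (ys i)) = ?S n" for n
    by (auto simp: substitution_def)
  \<comment> \<open>The intersection depends only on the coordinates of \<open>a\<close> and on the
    finitely many \<open>ys i\<close> whose values are substituted.\<close>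
  have S: "cyl_measure \<alpha> (?S n) = emeasure (cube_measure \<alpha>) (?S n)" for n
  proof (rule cyl_measure_eq_cube_measure[OF assms(1)])
    show "finite (F \<union> ys ` {1..n})" "F \<union> ys ` {1..n} \<subseteq> Field \<alpha>"
      using F ys by auto
    show "?S n \<in> sets (cube_measure \<alpha>)"
      using sets_PiM_diagonal_substitution[OF y _ a] ys unfolding space_cube_measure[symmetric]
      by (intro sets.sets_Collect_finite_All) auto
    show "depends_on \<alpha> (F \<union> ys ` {1..n}) (?S n)"
      unfolding depends_on_def
    proof (intro ballI impI)
      fix r s assume rs: "r \<in> cube \<alpha>" "s \<in> cube \<alpha>" "\<forall>i\<in>F \<union> ys ` {1..n}. r i = s i"
      have "r(y := r (ys i)) \<in> a \<longleftrightarrow> s(y := s (ys i)) \<in> a" if "i \<in> {1..n}" for i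
      proof -
        have "s (ys i) \<in> {0..<1}"
          using rs(2) ys[of i] that by (auto simp: cube_def)
        then show ?thesis
          using dep_upd[OF rs(1,2)] rs(3) that by auto
      qed
      then show "r \<in> ?S n \<longleftrightarrow> s \<in> ?S n"
        using rs(1,2) by auto
    qed
  qed
  \<comment> \<open>Sections of the measurable set \<open>a\<close> are Borel, so Lebesgue measure
    and \<open>unit_lborel\<close> agree on them.\<close>
  have "emeasure lebesgue (section_through a y r) = ?f r" if "r \<in> cube \<alpha>" for r
  proof -
    have "{u \<in> {0..<1}. r(y := u) \<in> a} \<in> sets unit_lborel"
      using section_upd_sets[OF y a, of r] that by (simp add: space_cube_measure)
    then show ?thesis
      by (simp add: section_through_def sets_unit_lborel emeasure_unit_lborel)
  qed
  then have full_eq: "full_section \<alpha> y a = {r \<in> cube \<alpha>. ?f r = 1}"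
    by (auto simp: full_section_def)
  \<comment> \<open>Points that agree on \<open>F\<close> have the same section in direction
    \<open>y\<close>, so the full-section set depends on \<open>F\<close> alone.\<close>
  have full: "cyl_measure \<alpha> {r \<in> cube \<alpha>. ?f r = 1} =
      emeasure (cube_measure \<alpha>) {r \<in> cube \<alpha>. ?f r = 1}"
  proof (rule cyl_measure_eq_cube_measure[OF assms(1) F])
    have [measurable]: "?f \<in> borel_measurable (cube_measure \<alpha>)"
      using measurable_emeasure_section_upd[OF y a] by simp
    show "{r \<in> cube \<alpha>. ?f r = 1} \<in> sets (cube_measure \<alpha>)"
      unfolding space_cube_measure[symmetric] by measurable
    show "depends_on \<alpha> F {r \<in> cube \<alpha>. ?f r = 1}"
      unfolding depends_on_def
    proof (intro ballI impI)
      fix r s assume rs: "r \<in> cube \<alpha>" "s \<in> cube \<alpha>" "\<forall>i\<in>F. r i = s i"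
      then have "{u \<in> {0..<1}. r(y := u) \<in> a} = {u \<in> {0..<1}. s(y := u) \<in> a}"
        using dep_upd by blast
      then show "r \<in> {r \<in> cube \<alpha>. ?f r = 1} \<longleftrightarrow> s \<in> {r \<in> cube \<alpha>. ?f r = 1}"
        using rs by simp
    qed
  qed
  \<comment> \<open>The position of each \<open>ys i\<close> outside the dimension set supplies the
    required invariance of \<open>a\<close> under resampling.\<close>
  have "emeasure (cube_measure \<alpha>) {r \<in> cube \<alpha>. ?f r = 1} = (INF n. emeasure (cube_measure \<alpha>) (?S n))"
    using emeasure_full_section_eq_INF[OF y a assms(5) ys] upd_outside_dimension_set[OF assms(6)]
    by (simp add: space_cube_measure)
  then show ?thesis
    unfolding full_eq S_eq full S .
qed

end
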